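(* Let $E$ be a complex Banach space with open unit ball $B_E$. Then the composition mapping $$(f,g)\in(\mathcal{H}(B_E,B_E),\tau_0)\times(\mathcal{H}(B_E,B_E),\tau_0)\mapsto f\circ g\in(\mathcal{H}(B_E,B_E),\tau_0)$$ is continuous.
   Context: For an open subset $U$ of a complex Banach space $E$, $\mathcal{H}(U,E)$ is the space of holomorphic (i.e. complex Fréchet differentiable at every point of $U$) mappings $f:U\to E$, and $\mathcal{H}(U,U)$ is the set of those $f\in\mathcal{H}(U,E)$ with $f(U)\subset U$. The compact-open topology $\tau_0$ on $\mathcal{H}(U,E)$ is the locally convex topology generated by the seminorms $p_K(f)=\max\{\|f(x)\|:x\in K\}$, with $K$ ranging over the compact subsets of $U$; $\mathcal{H}(U,U)$ carries the induced topology. *)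

theory Defs
  imports "HOL-Analysis.Analysis"
begin

class scaleC =
  fixes scaleC :: "complex \<Rightarrow> 'a \<Rightarrow> 'a"  (infixr "*\<^sub>C" 75)

text \<open>The real structure inherited from \<^class>\<open>real_normed_vector\<close> is required to be the
  restriction of scalars of the complex one.\<close>

class complex_normed_vector = real_normed_vector + scaleC +
  assumes scaleC_add_right: "a *\<^sub>C (x + y) = a *\<^sub>C x + a *\<^sub>C y"
    and scaleC_add_left: "(a + b) *\<^sub>C x = a *\<^sub>C x + b *\<^sub>C x"
    and scaleC_scaleC: "a *\<^sub>C (b *\<^sub>C x) = (a * b) *\<^sub>C x"
    and scaleC_one: "1 *\<^sub>C x = x"
    and scaleR_scaleC: "r *\<^sub>R x = complex_of_real r *\<^sub>C x"
    and norm_scaleC: "norm (a *\<^sub>C x) = cmod a * norm x"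

class complex_banach = complex_normed_vector + complete_space

subclass (in complex_banach) banach ..

instantiation complex :: complex_banach
begin

definition scaleC_complex :: "complex \<Rightarrow> complex \<Rightarrow> complex"
  where "scaleC_complex a x = a * x"

instance
  by standard (simp_all add: scaleC_complex_def algebra_simps scaleR_conv_of_real norm_mult)

end

text \<open>\<^const>\<open>has_derivative\<close> makes \<open>D\<close> bounded and real linear; homogeneity over the complex
  numbers then makes it a bounded complex linear map.\<close>

definition complex_frechet_differentiable_at ::
    "('a::complex_normed_vector \<Rightarrow> 'b::complex_normed_vector) \<Rightarrow> 'a \<Rightarrow> bool"
  where "complex_frechet_differentiable_at f x \<longleftrightarrow>
    (\<exists>D. (f has_derivative D) (at x) \<and> (\<forall>c v. D (c *\<^sub>C v) = c *\<^sub>C D v))"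

text \<open>The holomorphic maps from an open set \<open>U\<close> into \<open>V\<close>. A map with domain \<open>U\<close> is represented by
  the function that is \<^const>\<open>undefined\<close> outside \<open>U\<close>, so that equality is equality on \<open>U\<close>.\<close>

definition holomorphic_maps ::
    "'a::complex_normed_vector set \<Rightarrow> 'b::complex_normed_vector set \<Rightarrow> ('a \<Rightarrow> 'b) set"
  where "holomorphic_maps U V =
    {f \<in> extensional U. (\<forall>x\<in>U. complex_frechet_differentiable_at f x) \<and> f ` U \<subseteq> V}"

text \<open>For \<open>f\<close> continuous and \<open>K\<close> compact and nonempty the supremum is a maximum; for \<open>K\<close> empty
  the seminorm is zero.\<close>

definition sup_seminorm :: "'a set \<Rightarrow> ('a \<Rightarrow> 'b::real_normed_vector) \<Rightarrow> real"
  where "sup_seminorm K f = (if K = {} then 0 else SUP x\<in>K. norm (f x))"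

text \<open>The topology on the holomorphic maps from \<open>U\<close> to the whole space that is generated by the
  seminorms of the compact subsets of \<open>U\<close>: their open balls form a subbase.\<close>

definition compact_open_topology :: "'a::complex_normed_vector set \<Rightarrow> ('a \<Rightarrow> 'a) topology"
  where "compact_open_topology U = topology_generated_by
    {{g \<in> holomorphic_maps U UNIV. sup_seminorm K (\<lambda>x. g x - f x) < e} | K f e.
      compact K \<and> K \<subseteq> U \<and> f \<in> holomorphic_maps U UNIV \<and> e > 0}"

definition compact_open_self_maps :: "'a::complex_normed_vector set \<Rightarrow> ('a \<Rightarrow> 'a) topology"
  where "compact_open_self_maps U =
    subtopology (compact_open_topology U) (holomorphic_maps U U)"

lemma topspace_compact_open_topology:
  "topspace (compact_open_topology U) = holomorphic_maps U UNIV"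
proof
  show "topspace (compact_open_topology U) \<subseteq> holomorphic_maps U UNIV"
    unfolding compact_open_topology_def topology_generated_by_topspace by blast
  show "holomorphic_maps U UNIV \<subseteq> topspace (compact_open_topology U)"
  proof
    fix f :: "'a \<Rightarrow> 'a" assume f: "f \<in> holomorphic_maps U UNIV"
    let ?B = "{g \<in> holomorphic_maps U UNIV. sup_seminorm {} (\<lambda>x. g x - f x) < 1}"
    have "f \<in> ?B" using f by (simp add: sup_seminorm_def)
    moreover have "compact ({} :: 'a set) \<and> {} \<subseteq> U \<and> f \<in> holomorphic_maps U UNIV \<and> (1::real) > 0"
      using f by simp
    ultimately show "f \<in> topspace (compact_open_topology U)"
      unfolding compact_open_topology_def topology_generated_by_topspace by blast
  qed
qed

lemma topspace_compact_open_self_maps: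
  "topspace (compact_open_self_maps U) = holomorphic_maps U U"
  by (auto simp: compact_open_self_maps_def topspace_compact_open_topology holomorphic_maps_def)

end

theory Submission
  imports Defs "HOL-Complex_Analysis.Conformal_Mappings"
begin

text \<open>Self maps of the unit ball are locally equicontinuous: composing with a norming functional
  reduces to the scalar Schwarz lemma, which gives
  \<open>norm (f y - f x) \<le> 2 * norm (y - x) / (1 - norm x)\<close> uniformly in \<open>f\<close>. For compact \<open>K\<close> the set
  \<open>L = g\<^sub>0 ` K\<close> is compact in the ball, and on \<open>K\<close>
  \<open>norm (f (g x) - f\<^sub>0 (g\<^sub>0 x)) \<le> norm (f (g x) - f (g\<^sub>0 x)) + norm (f (g\<^sub>0 x) - f\<^sub>0 (g\<^sub>0 x))\<close>,
  where the first term is controlled by the distance of \<open>g\<close> and \<open>g\<^sub>0\<close> on \<open>K\<close> and the second by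
  that of \<open>f\<close> and \<open>f\<^sub>0\<close> on \<open>L\<close>.\<close>

section \<open>Norming functionals\<close>

definition sublinear :: "('a::real_vector \<Rightarrow> real) \<Rightarrow> bool"
  where "sublinear p \<longleftrightarrow>
    (\<forall>x y. p (x + y) \<le> p x + p y) \<and> (\<forall>t\<ge>0. \<forall>x. p (t *\<^sub>R x) = t * p x)"

lemma sublinear_add: "sublinear p \<Longrightarrow> p (x + y) \<le> p x + p y"
  and sublinear_scaleR: "sublinear p \<Longrightarrow> t \<ge> 0 \<Longrightarrow> p (t *\<^sub>R x) = t * p x"
  by (simp_all add: sublinear_def)

lemma sublinear_zero: "sublinear p \<Longrightarrow> p 0 = 0"
  using sublinear_scaleR[of p 0 0] by simp

lemma sublinear_ge_minus: "sublinear p \<Longrightarrow> - p (- x) \<le> p x"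
  using sublinear_add[of p x "- x"] sublinear_zero[of p] by simp

text \<open>One inequality of homogeneity suffices: applied to \<open>inverse t\<close> and the
  point \<open>t *\<^sub>R x\<close> it yields the reverse one.\<close>

lemma sublinearI:
  fixes p :: "'a::real_vector \<Rightarrow> real"
  assumes add: "\<And>x y. p (x + y) \<le> p x + p y" and zero: "p 0 = 0"
    and le: "\<And>t x. t > 0 \<Longrightarrow> p (t *\<^sub>R x) \<le> t * p x"
  shows "sublinear p"
  unfolding sublinear_def
proof (intro conjI allI impI)
  fix t :: real and x assume "t \<ge> 0"
  show "p (t *\<^sub>R x) = t * p x"
  proof (cases "t = 0")
    case False
    with \<open>t \<ge> 0\<close> have t: "t > 0" by simp
    have "p x \<le> inverse t * p (t *\<^sub>R x)"
      using le[of "inverse t" "t *\<^sub>R x"] t by simp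
    then have "t * p x \<le> p (t *\<^sub>R x)" using t by (simp add: field_simps)
    with le[OF t] show ?thesis by (simp add: antisym)
  qed (simp add: zero)
qed (rule add)

lemma sublinear_norm: "sublinear (norm :: 'a::real_normed_vector \<Rightarrow> real)"
  by (simp add: sublinear_def norm_triangle_ineq)

text \<open>For sublinear \<open>p\<close>, this is the auxiliary functional of Hahn-Banach: it lies
  below \<open>p\<close> (parameter 0) and is at most \<open>- p y\<close> at \<open>- y\<close>
  (parameter 1), so any linear functional below it takes the value \<open>p y\<close> at
  \<open>y\<close>.\<close>

definition sublinear_shift :: "('a::real_vector \<Rightarrow> real) \<Rightarrow> 'a \<Rightarrow> 'a \<Rightarrow> real"
  where "sublinear_shift p y x = (INF t\<in>{0..}. p (x + t *\<^sub>R y) - t * p y)"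

lemma sublinear_shift_le:
  assumes "sublinear p" "t \<ge> 0"
  shows "sublinear_shift p y x \<le> p (x + t *\<^sub>R y) - t * p y"
  unfolding sublinear_shift_def
proof (rule cINF_lower)
  \<comment> \<open>A lower bound independent of \<open>t\<close>, so that the real infimum is a
    genuine one.\<close>
  have "- p (- x) \<le> p (x + t *\<^sub>R y) - t * p y" if "t \<ge> 0" for t
    using sublinear_add[OF assms(1), of "x + t *\<^sub>R y" "- x"] sublinear_scaleR[OF assms(1) that, of y]
    by simp
  then show "bdd_below ((\<lambda>t. p (x + t *\<^sub>R y) - t * p y) ` {0..})"
    by (auto intro!: bdd_belowI)
qed (use assms in simp)

lemma sublinear_shift_greatest:
  "(\<And>t. t \<ge> 0 \<Longrightarrow> c \<le> p (x + t *\<^sub>R y) - t * p y) \<Longrightarrow> c \<le> sublinear_shift p y x"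
  unfolding sublinear_shift_def by (rule cINF_greatest) auto

lemma sublinear_sublinear_shift:
  assumes p: "sublinear p"
  shows "sublinear (sublinear_shift p y)"
proof (rule sublinearI)
  fix x z
  \<comment> \<open>Parameters \<open>s\<close> for \<open>x\<close> and \<open>t\<close> for
    \<open>z\<close> are matched by \<open>s + t\<close> for \<open>x + z\<close>; the infimum is
    then taken over \<open>t\<close> first and over \<open>s\<close> afterwards.\<close>
  have *: "sublinear_shift p y (x + z) - (p (x + s *\<^sub>R y) - s * p y) \<le> p (z + t *\<^sub>R y) - t * p y"
    if "s \<ge> 0" "t \<ge> 0" for s t
    using sublinear_shift_le[OF p, of "s + t" y "x + z"] that
      sublinear_add[OF p, of "x + s *\<^sub>R y" "z + t *\<^sub>R y"]
    by (simp add: algebra_simps)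
  have "sublinear_shift p y (x + z) - sublinear_shift p y z \<le> p (x + s *\<^sub>R y) - s * p y"
    if "s \<ge> 0" for s
    using sublinear_shift_greatest[OF *[OF that]] by simp
  from sublinear_shift_greatest[OF this]
  show "sublinear_shift p y (x + z) \<le> sublinear_shift p y x + sublinear_shift p y z" by simp
next
  have "0 \<le> sublinear_shift p y 0"
    by (rule sublinear_shift_greatest) (simp add: sublinear_scaleR[OF p])
  then show "sublinear_shift p y 0 = 0"
    using sublinear_shift_le[OF p, of 0 y 0] by (simp add: sublinear_zero[OF p])
next
  fix t :: real and x assume t: "t > 0"
  \<comment> \<open>The parameter \<open>s\<close> at \<open>x\<close> corresponds to
    \<open>t * s\<close> at \<open>t *\<^sub>R x\<close>.\<close>
  have "inverse t * sublinear_shift p y (t *\<^sub>R x) \<le> p (x + s *\<^sub>R y) - s * p y" if "s \<ge> 0" for s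
  proof -
    have "sublinear_shift p y (t *\<^sub>R x) \<le> p (t *\<^sub>R x + (t * s) *\<^sub>R y) - t * s * p y"
      using sublinear_shift_le[OF p, of "t * s"] t that by simp
    also have "\<dots> = t * (p (x + s *\<^sub>R y) - s * p y)"
      using sublinear_scaleR[OF p, of t "x + s *\<^sub>R y"] t by (simp add: algebra_simps)
    finally show ?thesis using t by (simp add: field_simps)
  qed
  from sublinear_shift_greatest[OF this]
  show "sublinear_shift p y (t *\<^sub>R x) \<le> t * sublinear_shift p y x"
    using t by (simp add: field_simps)
qed

section \<open>Linear minorants of sublinear functionals\<close>

text \<open>Hahn--Banach without partial functionals: a pointwise minimal sublinear functional coincides
  with all its shifts, which forces additivity.\<close>

lemma minimal_sublinear_imp_linear:
  assumes q: "sublinear q"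
    and minimal: "\<And>r. sublinear r \<Longrightarrow> (\<And>x. r x \<le> q x) \<Longrightarrow> r = q"
  shows "linear q"
proof -
  have "sublinear_shift q y = q" for y
    using sublinear_shift_le[OF q, of 0 y]
    by (intro minimal sublinear_sublinear_shift q) simp
  \<comment> \<open>Parameter 1 in the infimum gives superadditivity.\<close>
  then have "q x + q y \<le> q (x + y)" for x y
    using sublinear_shift_le[OF q, of 1 y x] by simp
  with sublinear_add[OF q] have add: "q (x + y) = q x + q y" for x y
    by (meson antisym)
  have minus: "q (- x) = - q x" for x
    using add[of x "- x"] sublinear_zero[OF q] by simp
  have "q (t *\<^sub>R x) = t * q x" for t x
  proof (cases "t \<ge> 0")
    case False
    then show ?thesis
      using sublinear_scaleR[OF q, of "- t" x] minus[of "t *\<^sub>R x"] by simp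
  qed (simp add: sublinear_scaleR[OF q])
  with add show ?thesis by (intro linearI) auto
qed

text \<open>Infima of sublinear functionals need not be subadditive, but in a chain two members, one
  evaluated at \<open>x\<close> and the other at \<open>y\<close>, can both be replaced by the
  smaller one. The common bound \<open>p\<close> keeps the infima finite, since every member is at
  least \<open>- p (- x)\<close> at \<open>x\<close>.\<close>

lemma sublinear_INF_chain:
  assumes ne: "C \<noteq> {}" and sub: "\<And>r. r \<in> C \<Longrightarrow> sublinear r"
    and bound: "\<And>r x. r \<in> C \<Longrightarrow> r x \<le> p x"
    and chain: "\<And>r s. r \<in> C \<Longrightarrow> s \<in> C \<Longrightarrow> (\<forall>x. r x \<le> s x) \<or> (\<forall>x. s x \<le> r x)"
  shows "sublinear (\<lambda>x. INF r\<in>C. r x)" and "r \<in> C \<Longrightarrow> (INF r\<in>C. r x) \<le> r x"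
proof -
  have "- p (- x) \<le> r x" if "r \<in> C" for r x
    using sublinear_ge_minus[OF sub[OF that], of x] bound[OF that, of "- x"] by linarith
  then have bdd: "bdd_below ((\<lambda>r. r x) ` C)" for x
    by (auto intro!: bdd_belowI)
  then show lower: "(INF r\<in>C. r x) \<le> r x" if "r \<in> C" for r x
    using that by (intro cINF_lower)
  show "sublinear (\<lambda>x. INF r\<in>C. r x)"
  proof (rule sublinearI)
    fix x y
    have *: "(INF r\<in>C. r (x + y)) \<le> r x + s y" if rs: "r \<in> C" "s \<in> C" for r s
      using chain[OF rs]
    proof
      assume "\<forall>x. r x \<le> s x"
      then have "r y \<le> s y" by blast
      with lower[OF rs(1), of "x + y"] sublinear_add[OF sub[OF rs(1)], of x y]
      show ?thesis by linarith
    next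
      assume "\<forall>x. s x \<le> r x"
      then have "s x \<le> r x" by blast
      with lower[OF rs(2), of "x + y"] sublinear_add[OF sub[OF rs(2)], of x y]
      show ?thesis by linarith
    qed
    have "(INF r\<in>C. r (x + y)) - r x \<le> (INF s\<in>C. s y)" if "r \<in> C" for r
      using *[OF that] by (intro cINF_greatest[OF ne]) (simp add: algebra_simps)
    then have "(INF r\<in>C. r (x + y)) - (INF s\<in>C. s y) \<le> (INF r\<in>C. r x)"
      by (intro cINF_greatest[OF ne]) (simp add: algebra_simps)
    then show "(INF r\<in>C. r (x + y)) \<le> (INF r\<in>C. r x) + (INF r\<in>C. r y)" by simp
  next
    have "(INF r\<in>C. r 0) = (INF r\<in>C. 0)"
      by (intro INF_cong) (simp_all add: sublinear_zero sub)
    then show "(INF r\<in>C. r 0) = 0" using ne by simp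
  next
    fix t :: real and x assume t: "t > 0"
    have "inverse t * (INF r\<in>C. r (t *\<^sub>R x)) \<le> r x" if "r \<in> C" for r
      using lower[OF that, of "t *\<^sub>R x"] sublinear_scaleR[OF sub[OF that], of t x] t
      by (simp add: field_simps)
    then have "inverse t * (INF r\<in>C. r (t *\<^sub>R x)) \<le> (INF r\<in>C. r x)"
      by (intro cINF_greatest[OF ne])
    then show "(INF r\<in>C. r (t *\<^sub>R x)) \<le> t * (INF r\<in>C. r x)"
      using t by (simp add: field_simps)
  qed
qed

text \<open>Zorn's lemma gives a minimal element among the sublinear functionals below
  \<open>p\<close>, and minimality makes it linear.\<close>

lemma sublinear_dominates_linear:
  fixes p :: "'a::real_vector \<Rightarrow> real"
  assumes p: "sublinear p"
  shows "\<exists>q. linear q \<and> (\<forall>x. q x \<le> p x)"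
proof -
  define A where "A = {r. sublinear r \<and> (\<forall>x. r x \<le> p x)}"
  \<comment> \<open>The pointwise order is reversed, so that Zorn's maximal elements are pointwise
    minimal.\<close>
  define P where "P r s \<longleftrightarrow> (\<forall>x. s x \<le> r x)" for r s :: "'a \<Rightarrow> real"
  have "\<exists>m\<in>A. \<forall>a\<in>A. P m a \<longrightarrow> a = m"
  proof (rule predicate_Zorn)
    show "partial_order_on A (relation_of P A)"
      by (rule partial_order_on_relation_ofI)
        (auto simp: P_def fun_eq_iff intro: order_trans antisym)
    fix C assume C: "C \<in> Chains (relation_of P A)"
    then have CA: "r \<in> A" and cmp: "P r s \<or> P s r" if "r \<in> C" "s \<in> C" for r s
      using that by (auto simp: Chains_def relation_of_def)
    show "\<exists>u\<in>A. \<forall>a\<in>C. P a u"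
    proof (cases "C = {}")
      case True
      then show ?thesis using p by (auto simp: A_def)
    next
      case False
      have sub: "sublinear r" and bound: "r x \<le> p x" if "r \<in> C" for r x
        using CA that by (auto simp: A_def)
      have chain: "(\<forall>x. r x \<le> s x) \<or> (\<forall>x. s x \<le> r x)" if "r \<in> C" "s \<in> C" for r s
        using cmp[OF that] by (auto simp: P_def)
      let ?u = "\<lambda>x. INF r\<in>C. r x"
      have u: "sublinear ?u"
        by (rule sublinear_INF_chain(1)[where p = p]) (use False sub bound chain in blast)+
      have lower: "?u x \<le> r x" if "r \<in> C" for r x
        by (rule sublinear_INF_chain(2)[where p = p]) (use that False sub bound chain in blast)+
      have "?u x \<le> p x" for x
        using False lower bound by (meson ex_in_conv order_trans)
      with u lower show ?thesis by (intro bexI[of _ ?u]) (auto simp: A_def P_def)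
    qed
  qed
  then obtain q where q: "sublinear q" "\<And>x. q x \<le> p x"
    and minimal: "\<And>r. r \<in> A \<Longrightarrow> P q r \<Longrightarrow> r = q"
    by (auto simp: A_def)
  have "linear q"
  \<comment> \<open>Minimality within \<open>A\<close> is minimality among all sublinear
    functionals, because whatever lies below \<open>q\<close> lies below \<open>p\<close>.\<close>
  proof (rule minimal_sublinear_imp_linear[OF q(1)])
    fix r assume "sublinear r" "\<And>x. r x \<le> q x"
    then show "r = q"
      using q(2) by (intro minimal) (auto simp: A_def P_def intro: order_trans)
  qed
  with q(2) show ?thesis by blast
qed

section \<open>Real and complex norming functionals\<close>

text \<open>A linear functional below the shift of the norm along \<open>v\<close> is dominated by
  the norm and is at most \<open>- norm v\<close> at \<open>- v\<close>, which forces equality at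
  \<open>v\<close>.\<close>

lemma exists_real_norming_functional:
  fixes v :: "'a::real_normed_vector"
  shows "\<exists>q. linear q \<and> (\<forall>x. q x \<le> norm x) \<and> q v = norm v"
proof -
  let ?s = "sublinear_shift norm v"
  obtain q where q: "linear q" "\<And>x. q x \<le> ?s x"
    using sublinear_dominates_linear[OF sublinear_sublinear_shift[OF sublinear_norm]] by metis
  have le: "q x \<le> norm x" for x
    using q(2)[of x] sublinear_shift_le[OF sublinear_norm, of 0 v x] by simp
  have "q (- v) \<le> - norm v"
    using q(2)[of "- v"] sublinear_shift_le[OF sublinear_norm, of 1 v "- v"] by simp
  then have "q v = norm v"
    using le[of v] by (simp add: linear_neg[OF q(1)])
  with q(1) le show ?thesis by blast
qed

lemma scaleC_scaleR: "c *\<^sub>C (r *\<^sub>R x) = r *\<^sub>R (c *\<^sub>C (x::'a::complex_normed_vector))"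
  by (simp add: scaleR_scaleC scaleC_scaleC mult.commute)

text \<open>A real norming functional \<open>q\<close> is the real part of the complex linear
  functional sending \<open>x\<close> to \<open>q x\<close> minus \<i> times the value of
  \<open>q\<close> at \<i> times \<open>x\<close>; a rotation transfers the norm bound.\<close>

lemma exists_complex_norming_functional:
  fixes v :: "'a::complex_normed_vector"
  obtains \<phi> :: "'a \<Rightarrow> complex" where
    "bounded_linear \<phi>" "\<And>c x. \<phi> (c *\<^sub>C x) = c * \<phi> x" "\<And>x. cmod (\<phi> x) \<le> norm x" "\<phi> v = norm v"
proof -
  obtain q where q: "linear q" "\<And>x. q x \<le> norm x" "q v = norm v"
    using exists_real_norming_functional[of v] by blast
  define \<phi> where "\<phi> x = Complex (q x) (- q (\<i> *\<^sub>C x))" for x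
  have add: "\<phi> (x + y) = \<phi> x + \<phi> y" for x y
    by (simp add: \<phi>_def scaleC_add_right linear_add[OF q(1)] complex_eq_iff)
  have scale: "\<phi> (c *\<^sub>C x) = c * \<phi> x" for c x
  proof -
    have "c *\<^sub>C x = Re c *\<^sub>R x + Im c *\<^sub>R (\<i> *\<^sub>C x)"
      unfolding scaleR_scaleC scaleC_scaleC scaleC_add_left[symmetric]
      by (metis complex_eq mult.commute)
    moreover have "\<i> *\<^sub>C (\<i> *\<^sub>C x) = - x"
      using scaleR_scaleC[of "-1" x] by (simp add: scaleC_scaleC)
    ultimately show ?thesis
      by (simp add: \<phi>_def scaleC_add_right scaleC_scaleR linear_add[OF q(1)] linear_neg[OF q(1)]
          linear_diff[OF q(1)] linear_scale[OF q(1)] complex_eq_iff algebra_simps)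
  qed
  have bound: "cmod (\<phi> x) \<le> norm x" for x
  proof (cases "\<phi> x = 0")
    case False
    \<comment> \<open>A unimodular factor that turns \<phi> x into its modulus, a real number to
      which the bound on \<open>q\<close> applies.\<close>
    define c where "c = cnj (\<phi> x) / cmod (\<phi> x)"
    have "c * \<phi> x = cmod (\<phi> x)"
      using False complex_norm_square[of "\<phi> x"]
      by (simp add: c_def divide_eq_eq power2_eq_square mult.commute[of "cnj (\<phi> x)"])
    then have "cmod (\<phi> x) = Re (\<phi> (c *\<^sub>C x))" by (simp add: scale)
    also have "\<dots> \<le> norm (c *\<^sub>C x)" using q(2) by (simp add: \<phi>_def)
    also have "\<dots> = norm x" using False by (simp add: c_def norm_scaleC norm_divide)
    finally show ?thesis .
  qed simp
  have "bounded_linear \<phi>"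
    using bound by (intro bounded_linear_intro[where K = 1])
      (simp_all add: add scale scaleR_scaleC[where 'a = 'a] scaleR_conv_of_real)
  moreover have "\<phi> v = norm v"
  proof -
    \<comment> \<open>The real part alone exhausts the bound on the modulus, so no imaginary part is
      left.\<close>
    have "Re (\<phi> v) = norm v" by (simp add: \<phi>_def q)
    moreover from this have "Im (\<phi> v) = 0"
      using bound[of v] cmod_power2[of "\<phi> v"] power_mono[of "cmod (\<phi> v)" "norm v" 2] by simp
    ultimately show ?thesis by (simp add: complex_eq_iff)
  qed
  ultimately show thesis using that scale bound by blast
qed

section \<open>Holomorphic self maps of the ball\<close>

lemma bounded_linear_scaleC_left: "bounded_linear (\<lambda>c. c *\<^sub>C (e::'a::complex_normed_vector))"
  by (rule bounded_linear_intro[where K = "norm e"])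
    (simp_all add: scaleC_add_left norm_scaleC scaleR_conv_of_real scaleC_scaleC[symmetric]
      scaleR_scaleC[symmetric])

lemma holomorphic_mapsD:
  assumes "f \<in> holomorphic_maps U V" "x \<in> U"
  shows "complex_frechet_differentiable_at f x" "f x \<in> V"
  using assms by (auto simp: holomorphic_maps_def)

lemma continuous_on_holomorphic_maps: "f \<in> holomorphic_maps U V \<Longrightarrow> continuous_on U f"
  by (auto simp: holomorphic_maps_def complex_frechet_differentiable_at_def
      intro!: continuous_at_imp_continuous_on intro: has_derivative_continuous)

lemma complex_frechet_differentiable_compose:
  assumes "complex_frechet_differentiable_at g x" "complex_frechet_differentiable_at f (g x)"
  shows "complex_frechet_differentiable_at (\<lambda>x. f (g x)) x"
proof -
  obtain D where D: "(g has_derivative D) (at x)" "\<And>c v. D (c *\<^sub>C v) = c *\<^sub>C D v"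
    using assms(1) by (auto simp: complex_frechet_differentiable_at_def)
  obtain D' where D': "(f has_derivative D') (at (g x))" "\<And>c v. D' (c *\<^sub>C v) = c *\<^sub>C D' v"
    using assms(2) by (auto simp: complex_frechet_differentiable_at_def)
  show ?thesis
    unfolding complex_frechet_differentiable_at_def
    using has_derivative_compose[OF D(1) D'(1)] D(2) D'(2) by (intro exI conjI) auto
qed

lemma compose_holomorphic_maps:
  assumes U: "open U" and f: "f \<in> holomorphic_maps V W" and g: "g \<in> holomorphic_maps U V"
  shows "compose U f g \<in> holomorphic_maps U W"
  unfolding holomorphic_maps_def
proof (intro CollectI conjI ballI)
  fix x assume x: "x \<in> U"
  have "complex_frechet_differentiable_at (\<lambda>x. f (g x)) x"
    by (rule complex_frechet_differentiable_compose[OF holomorphic_mapsD(1)[OF g x]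
        holomorphic_mapsD(1)[OF f holomorphic_mapsD(2)[OF g x]]])
  then obtain D where D: "((\<lambda>x. f (g x)) has_derivative D) (at x)"
      "\<forall>c v. D (c *\<^sub>C v) = c *\<^sub>C D v"
    by (auto simp: complex_frechet_differentiable_at_def)
  \<comment> \<open>\<open>compose U f g\<close> is \<open>undefined\<close> off \<open>U\<close>;
    since \<open>U\<close> is open, it agrees with the plain composite near
    \<open>x\<close>.\<close>
  have "(compose U f g has_derivative D) (at x)"
    by (rule has_derivative_transform_within_open[OF D(1) U x]) (simp add: compose_def)
  with D(2) show "complex_frechet_differentiable_at (compose U f g) x"
    by (auto simp: complex_frechet_differentiable_at_def)
qed (use holomorphic_mapsD(2)[OF f] holomorphic_mapsD(2)[OF g] in \<open>auto simp: compose_def\<close>)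

section \<open>Local equicontinuity from the Schwarz lemma\<close>

lemma holomorphic_self_map_lipschitz:
  fixes f :: "'a::complex_normed_vector \<Rightarrow> 'b::complex_normed_vector"
  assumes f: "f \<in> holomorphic_maps (ball 0 1) (ball 0 1)"
    and x: "norm x < 1" and y: "norm (y - x) < 1 - norm x"
  shows "norm (f y - f x) \<le> 2 * norm (y - x) / (1 - norm x)"
proof (cases "y = x")
  case False
  \<comment> \<open>The complex line through \<open>x\<close> and \<open>y\<close> is parametrised
    so that the unit disc stays in the ball: \<open>e\<close> has norm \<open>R\<close> and
    \<open>y\<close> is reached at the parameter \<open>t < 1\<close>.\<close>
  define R where "R = 1 - norm x"
  define e where "e = (R / norm (y - x)) *\<^sub>R (y - x)"
  define t where "t = norm (y - x) / R"
  have R: "R > 0" and t: "0 \<le> t" "t < 1"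
    using x y by (auto simp: R_def t_def)
  have e: "norm e = R" and "t *\<^sub>R e = y - x"
    using False R by (auto simp: e_def t_def)
  then have te: "complex_of_real t *\<^sub>C e = y - x"
    by (simp add: scaleR_scaleC)
  obtain \<phi> :: "'b \<Rightarrow> complex" where \<phi>: "bounded_linear \<phi>" "\<And>c z. \<phi> (c *\<^sub>C z) = c * \<phi> z"
    "\<And>z. cmod (\<phi> z) \<le> norm z" "\<phi> (f y - f x) = norm (f y - f x)"
    using exists_complex_norming_functional[of "f y - f x"] by blast
  \<comment> \<open>Subtracting the value at 0 gives \<open>k 0 = 0\<close>. A difference of two
    numbers of modulus below 1 has modulus below 2, so halving makes \<open>k\<close> a self map of
    the disc; this is the source of the factor 2.\<close>
  define k where "k \<zeta> = (\<phi> (f (x + \<zeta> *\<^sub>C e)) - \<phi> (f x)) / 2" for \<zeta>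
  have in_ball: "x + \<zeta> *\<^sub>C e \<in> ball 0 1" if "norm \<zeta> < 1" for \<zeta>
  proof -
    have "norm (x + \<zeta> *\<^sub>C e) \<le> norm x + norm \<zeta> * R"
      using norm_triangle_ineq[of x "\<zeta> *\<^sub>C e"] by (simp add: norm_scaleC e)
    also have "\<dots> < norm x + 1 * R"
      using that R by (intro add_strict_left_mono mult_strict_right_mono)
    finally show ?thesis by (simp add: R_def)
  qed
  have f_bound: "norm (f z) < 1" if "z \<in> ball 0 1" for z
    using holomorphic_mapsD(2)[OF f that] by simp
  have "norm (k (complex_of_real t)) \<le> norm (complex_of_real t)"
  proof (rule Schwarz_Lemma(1))
    show "k holomorphic_on ball 0 1"
    proof (rule holomorphic_onI)
      fix \<zeta> :: complex assume "\<zeta> \<in> ball 0 1"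
      then obtain D where D: "(f has_derivative D) (at (x + \<zeta> *\<^sub>C e))"
          "\<And>c v. D (c *\<^sub>C v) = c *\<^sub>C D v"
        using holomorphic_mapsD(1)[OF f in_ball, of \<zeta>]
        unfolding complex_frechet_differentiable_at_def by auto
      have "((\<lambda>\<zeta>. x + \<zeta> *\<^sub>C e) has_derivative (\<lambda>c. c *\<^sub>C e)) (at \<zeta>)"
        using has_derivative_add[OF has_derivative_const
            bounded_linear_imp_has_derivative[OF bounded_linear_scaleC_left]] by simp
      from bounded_linear.has_derivative[OF \<phi>(1) has_derivative_compose[OF this D(1)]]
      \<comment> \<open>Complex homogeneity of \<open>D\<close> and \<phi> turns the real derivative
        into multiplication by a complex number.\<close>
      have "((\<lambda>\<zeta>. \<phi> (f (x + \<zeta> *\<^sub>C e))) has_field_derivative \<phi> (D e)) (at \<zeta>)"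
        by (simp add: has_field_derivative_def D(2) \<phi>(2) mult_commute_abs)
      then have "(k has_field_derivative \<phi> (D e) / 2) (at \<zeta>)"
        unfolding k_def by (auto intro!: derivative_eq_intros)
      then show "k field_differentiable at \<zeta> within ball 0 1"
        using field_differentiable_at_within field_differentiable_def by blast
    qed
    show "k 0 = 0"
      by (simp add: k_def linear_0[OF bounded_linear.linear[OF bounded_linear_scaleC_left]])
    show "norm (k \<zeta>) < 1" if "norm \<zeta> < 1" for \<zeta>
      using norm_triangle_ineq4[of "\<phi> (f (x + \<zeta> *\<^sub>C e))" "\<phi> (f x)"] f_bound[of x] x
        \<phi>(3)[of "f x"] \<phi>(3)[of "f (x + \<zeta> *\<^sub>C e)"] f_bound[OF in_ball[OF that]]
      by (simp add: k_def norm_divide)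
    show "norm (complex_of_real t) < 1" using t by simp
  qed
  moreover have "k (complex_of_real t) = \<phi> (f y - f x) / 2"
    by (simp add: k_def te linear_simps[OF \<phi>(1)])
  ultimately have "norm (f y - f x) \<le> 2 * t"
    using t \<phi>(4) by (simp add: norm_divide)
  then show ?thesis by (simp add: t_def R_def)
qed simp

section \<open>The compact-open topology\<close>

lemma sup_seminorm_lessD:
  assumes "compact K" "continuous_on K f" "sup_seminorm K f < c" "x \<in> K"
  shows "norm (f x) < c"
proof -
  have "bdd_above ((\<lambda>x. norm (f x)) ` K)"
    using assms by (intro bounded_imp_bdd_above compact_imp_bounded compact_continuous_image
        continuous_on_norm)
  from cSUP_upper[OF assms(4) this] show ?thesis
    using assms(3,4) by (auto simp: sup_seminorm_def split: if_splits)
qed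

text \<open>The condition \<open>c \<ge> 0\<close> covers empty \<open>K\<close>, where the seminorm
  is 0 by convention.\<close>

lemma sup_seminorm_le:
  "(\<And>x. x \<in> K \<Longrightarrow> norm (f x) \<le> c) \<Longrightarrow> c \<ge> 0 \<Longrightarrow> sup_seminorm K f \<le> c"
  by (auto simp: sup_seminorm_def intro: cSUP_least)

lemma sup_seminorm_ge:
  assumes "compact K" "continuous_on K f" "x \<in> K"
  shows "norm (f x) \<le> sup_seminorm K f"
  using sup_seminorm_lessD[OF assms(1,2) _ assms(3), of "norm (f x)"] by force

lemma holomorphic_maps_mono: "V \<subseteq> W \<Longrightarrow> holomorphic_maps U V \<subseteq> holomorphic_maps U W"
  by (auto simp: holomorphic_maps_def)

text \<open>The trace of a subbasic ball on the self maps; such sets serve as the factors of product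
  neighbourhoods.\<close>

lemma openin_compact_open_self_maps_seminorm:
  assumes "compact K" "K \<subseteq> U" "f \<in> holomorphic_maps U U" "e > 0"
  shows "openin (compact_open_self_maps U)
    {g \<in> holomorphic_maps U U. sup_seminorm K (\<lambda>x. g x - f x) < e}"
proof -
  have "f \<in> holomorphic_maps U UNIV"
    using assms(3) holomorphic_maps_mono by blast
  with assms have "openin (compact_open_topology U)
      {g \<in> holomorphic_maps U UNIV. sup_seminorm K (\<lambda>x. g x - f x) < e}"
    unfolding compact_open_topology_def by (intro topology_generated_by_Basis) blast
  then have "openin (compact_open_self_maps U)
      ({g \<in> holomorphic_maps U UNIV. sup_seminorm K (\<lambda>x. g x - f x) < e} \<inter> holomorphic_maps U U)"
    unfolding compact_open_self_maps_def by (rule openin_subtopology_Int)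
  also have "{g \<in> holomorphic_maps U UNIV. sup_seminorm K (\<lambda>x. g x - f x) < e} \<inter> holomorphic_maps U U
      = {g \<in> holomorphic_maps U U. sup_seminorm K (\<lambda>x. g x - f x) < e}"
    using holomorphic_maps_mono by blast
  finally show ?thesis .
qed

lemma sup_seminorm_zero: "sup_seminorm K (\<lambda>x. 0) = 0"
  by (simp add: sup_seminorm_def)

section \<open>Continuity of composition\<close>

text \<open>Subbasic balls have an arbitrary centre \<open>h\<close>, so the perturbation of
  \<open>f0\<close> and \<open>g0\<close> may only use up the gap between \<open>e\<close> and the
  seminorm of the unperturbed composite minus \<open>h\<close>.\<close>

lemma sup_seminorm_compose_less:
  fixes f0 g0 :: "'a::complex_normed_vector \<Rightarrow> 'a"
  assumes B_def: "B = ball 0 1" and f0: "f0 \<in> holomorphic_maps B B" and g0: "g0 \<in> holomorphic_maps B B"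
    and h: "h \<in> holomorphic_maps B UNIV" and K: "compact K" "K \<subseteq> B"
    and less: "sup_seminorm K (\<lambda>x. compose B f0 g0 x - h x) < e"
  obtains d where "d > 0"
    "\<And>f g. \<lbrakk>f \<in> holomorphic_maps B B; g \<in> holomorphic_maps B B;
      sup_seminorm (g0 ` K) (\<lambda>x. f x - f0 x) < d; sup_seminorm K (\<lambda>x. g x - g0 x) < d\<rbrakk>
      \<Longrightarrow> sup_seminorm K (\<lambda>x. compose B f g x - h x) < e"
proof (cases "K = {}")
  case True
  with less show ?thesis by (intro that[of 1]) (simp_all add: sup_seminorm_def)
next
  case False
  let ?s = "sup_seminorm K (\<lambda>x. compose B f0 g0 x - h x)"
  \<comment> \<open>A quarter of the gap: two errors of size \<eta> use up half of it and leave the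
    inequality strict.\<close>
  define \<eta> where "\<eta> = (e - ?s) / 4"
  have \<eta>: "\<eta> > 0" using less by (simp add: \<eta>_def)
  have cont: "continuous_on A f" if "A \<subseteq> B" "f \<in> holomorphic_maps B V"
    for A V and f :: "'a \<Rightarrow> 'a"
    using that continuous_on_holomorphic_maps continuous_on_subset by blast
  have L: "compact (g0 ` K)" "g0 ` K \<subseteq> B"
    using K g0 holomorphic_mapsD(2)[OF g0] by (auto intro!: compact_continuous_image cont)
  \<comment> \<open>The point of the compact image farthest from 0 gives one \<open>R\<close> that
    serves the Lipschitz estimate on the whole image.\<close>
  obtain z where z: "z \<in> g0 ` K" "\<And>w. w \<in> g0 ` K \<Longrightarrow> norm w \<le> norm z"
    using continuous_attains_sup[OF L(1), of norm] False
    by (auto intro: continuous_intros)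
  define R where "R = 1 - norm z"
  have R: "R > 0" using z(1) L(2) by (auto simp: R_def B_def)
  \<comment> \<open>The bound \<open>R\<close> keeps \<open>g x\<close> within reach of the
    Lipschitz estimate around \<open>g0 x\<close>, \<open>\<eta> * R / 2\<close> makes that estimate
    at most \<eta>, and \<eta> bounds the change from \<open>f0\<close> to \<open>f\<close>.\<close>
  define d where "d = min (min \<eta> R) (\<eta> * R / 2)"
  have d: "d > 0" "d \<le> \<eta>" "d \<le> R" "d \<le> \<eta> * R / 2"
    using \<eta> R by (auto simp: d_def)
  have fg0: "compose B f0 g0 \<in> holomorphic_maps B B"
    using f0 g0 by (intro compose_holomorphic_maps) (simp_all add: B_def)
  show ?thesis
  proof (rule that[OF d(1)])
    fix f g assume f: "f \<in> holomorphic_maps B B" and g: "g \<in> holomorphic_maps B B"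
      and df: "sup_seminorm (g0 ` K) (\<lambda>x. f x - f0 x) < d"
      and dg: "sup_seminorm K (\<lambda>x. g x - g0 x) < d"
    have "norm (compose B f g x - h x) \<le> ?s + 2 * \<eta>" if x: "x \<in> K" for x
    proof -
      have xB: "x \<in> B" using x K by blast
      have g0x: "norm (g0 x) \<le> 1 - R" using z(2)[of "g0 x"] x by (simp add: R_def)
      have gd: "norm (g x - g0 x) < d"
        using f g f0 g0 K dg x
        by (intro sup_seminorm_lessD[OF K(1) _ dg x] continuous_on_diff cont)
      \<comment> \<open>The estimate is centred at \<open>g0 x\<close>, so its constant depends on
        neither \<open>f\<close> nor \<open>g\<close>.\<close>
      have "norm (f (g x) - f (g0 x)) \<le> 2 * norm (g x - g0 x) / (1 - norm (g0 x))"
        using f gd g0x d(3) R by (intro holomorphic_self_map_lipschitz) (auto simp: B_def)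
      also have "\<dots> \<le> 2 * d / R"
        using gd g0x R d(1) by (intro frac_le) auto
      also have "\<dots> \<le> \<eta>" using d(4) R by (simp add: field_simps)
      finally have 1: "norm (f (g x) - f (g0 x)) \<le> \<eta>" .
      have "norm (f (g0 x) - f0 (g0 x)) < d"
        using x f f0 L by (intro sup_seminorm_lessD[OF L(1) _ df] continuous_on_diff cont) auto
      then have 2: "norm (f (g0 x) - f0 (g0 x)) \<le> \<eta>" using d(2) by simp
      have "norm (compose B f0 g0 x - h x) \<le> ?s"
        using fg0 h K by (intro sup_seminorm_ge[OF K(1) _ x] continuous_on_diff cont)
      then have 3: "norm (f0 (g0 x) - h x) \<le> ?s" using xB by (simp add: compose_def)
      have "f (g x) - h x = (f (g x) - f (g0 x)) + (f (g0 x) - f0 (g0 x)) + (f0 (g0 x) - h x)"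
        by simp
      then have "norm (f (g x) - h x) \<le> norm (f (g x) - f (g0 x)) + norm (f (g0 x) - f0 (g0 x))
          + norm (f0 (g0 x) - h x)"
        by (metis norm_triangle_le norm_triangle_ineq add_right_mono)
      with 1 2 3 show ?thesis using xB by (simp add: compose_def)
    qed
    moreover have "?s \<ge> 0"
    proof -
      obtain x where x: "x \<in> K" using False by blast
      have "norm (compose B f0 g0 x - h x) \<le> ?s"
        using fg0 h K by (intro sup_seminorm_ge[OF K(1) _ x] continuous_on_diff cont)
      then show ?thesis using norm_ge_zero order_trans by blast
    qed
    ultimately have "sup_seminorm K (\<lambda>x. compose B f g x - h x) \<le> ?s + 2 * \<eta>"
      using \<eta> by (intro sup_seminorm_le) auto
    also have "\<dots> < e" using \<eta> by (simp add: \<eta>_def field_simps)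
    finally show "sup_seminorm K (\<lambda>x. compose B f g x - h x) < e" .
  qed
qed

theorem theorem2p1:
  "continuous_map
    (prod_topology (compact_open_self_maps (ball (0::'a::complex_banach) 1))
                   (compact_open_self_maps (ball (0::'a) 1)))
    (compact_open_self_maps (ball (0::'a) 1))
    (\<lambda>(f, g). compose (ball (0::'a) 1) f g)"
proof -
  define B where "B = ball (0::'a) 1"
  let ?X = "compact_open_self_maps B" and ?c = "\<lambda>(f, g). compose B f g"
  let ?H = "holomorphic_maps B B"
  have self: "compose B f g \<in> ?H" if "f \<in> ?H" "g \<in> ?H" for f g
    using that by (intro compose_holomorphic_maps) (simp_all add: B_def)
  \<comment> \<open>The target is first the space of all holomorphic maps, whose topology has a
    subbase: only preimages of subbasic balls need checking. The restriction to self maps follows at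
    the end.\<close>
  have "continuous_map (prod_topology ?X ?X) (compact_open_topology B) ?c"
    unfolding compact_open_topology_def
  proof (rule continuous_on_generated_topo, goal_cases)
    case (1 S)
    then obtain K h e where S: "S = {g \<in> holomorphic_maps B UNIV. sup_seminorm K (\<lambda>x. g x - h x) < e}"
      and K: "compact K" "K \<subseteq> B" and h: "h \<in> holomorphic_maps B UNIV"
      by blast
    show ?case
      unfolding openin_prod_topology_alt
    proof (intro allI impI)
      fix f0 g0 assume "(f0, g0) \<in> ?c -` S \<inter> topspace (prod_topology ?X ?X)"
      then have f0: "f0 \<in> ?H" and g0: "g0 \<in> ?H"
        and less: "sup_seminorm K (\<lambda>x. compose B f0 g0 x - h x) < e"
        by (auto simp: S topspace_compact_open_self_maps)
      obtain d where d: "d > 0"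
        "\<And>f g. \<lbrakk>f \<in> ?H; g \<in> ?H; sup_seminorm (g0 ` K) (\<lambda>x. f x - f0 x) < d;
          sup_seminorm K (\<lambda>x. g x - g0 x) < d\<rbrakk>
          \<Longrightarrow> sup_seminorm K (\<lambda>x. compose B f g x - h x) < e"
        using sup_seminorm_compose_less[OF B_def f0 g0 h K less] by blast
      have L: "compact (g0 ` K)" "g0 ` K \<subseteq> B"
        using K g0 holomorphic_mapsD(2)[OF g0] continuous_on_holomorphic_maps[OF g0]
        by (auto intro!: compact_continuous_image intro: continuous_on_subset)
      let ?V = "{f \<in> ?H. sup_seminorm (g0 ` K) (\<lambda>x. f x - f0 x) < d}"
      let ?W = "{g \<in> ?H. sup_seminorm K (\<lambda>x. g x - g0 x) < d}"
      \<comment> \<open>Closeness of \<open>f\<close> is required on the image of \<open>K\<close>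
        under \<open>g0\<close>, closeness of \<open>g\<close> on \<open>K\<close> itself.\<close>
      have "?V \<times> ?W \<subseteq> ?c -` S \<inter> topspace (prod_topology ?X ?X)"
        using d(2) self holomorphic_maps_mono[of B UNIV B] by (auto simp: S topspace_compact_open_self_maps)
      moreover have "openin ?X ?V" "openin ?X ?W"
        using L K f0 g0 d(1) by (simp_all add: openin_compact_open_self_maps_seminorm)
      moreover have "f0 \<in> ?V" "g0 \<in> ?W"
        using f0 g0 d(1) by (simp_all add: sup_seminorm_zero)
      ultimately show "\<exists>V W. openin ?X V \<and> openin ?X W \<and> f0 \<in> V \<and> g0 \<in> W \<and>
          V \<times> W \<subseteq> ?c -` S \<inter> topspace (prod_topology ?X ?X)"
        by blast
    qed
  next
    case 2
    have "?c ` topspace (prod_topology ?X ?X) \<subseteq> topspace (compact_open_topology B)"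
      using self holomorphic_maps_mono[of B UNIV B]
      by (auto simp: topspace_compact_open_self_maps topspace_compact_open_topology)
    then show ?case
      unfolding compact_open_topology_def topology_generated_by_topspace .
  qed
  moreover have "?c \<in> topspace (prod_topology ?X ?X) \<rightarrow> ?H"
    using self by (auto simp: topspace_compact_open_self_maps)
  ultimately have
    "continuous_map (prod_topology ?X ?X) (subtopology (compact_open_topology B) ?H) ?c"
    by (rule continuous_map_into_subtopology)
  then show ?thesis by (simp add: B_def compact_open_self_maps_def)
qed

end
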